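(* Let $F$ be R. Thompson's group and let $A=\{x_0,x_1,x_2\}\subset F$. Then there exists a finite subset $S\subset F$ satisfying $|AS|<\frac43|S|$, where $AS=\{as : a\in A,\ s\in S\}$.
   Context: R. Thompson's group $F$ is the group given by the presentation $\langle x_0,x_1,x_2,\ldots \mid x_jx_i=x_ix_{j+1}\ (0\le i<j)\rangle$. $|Y|$ denotes the cardinality of a finite set $Y$. *)

theory Defs
  imports Complex_Main "HOL-Algebra.Coset"
begin

text \<open>
  A letter \<open>(g, True)\<close> stands for the generator \<open>g\<close>, and \<open>(g, False)\<close> for its formal inverse.
\<close>

type_synonym 'g word = "('g \<times> bool) list"

text \<open>
  The congruence on words generated by free cancellation and by a set \<open>R\<close> of relations,
  where \<open>(u, v) \<in> R\<close> stands for the relation \<open>u = v\<close>.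
\<close>

inductive pres_eq :: "('g word \<times> 'g word) set \<Rightarrow> 'g word \<Rightarrow> 'g word \<Rightarrow> bool" for R where
  pres_refl: "pres_eq R u u"
| pres_sym: "pres_eq R u v \<Longrightarrow> pres_eq R v u"
| pres_trans: "pres_eq R u v \<Longrightarrow> pres_eq R v w \<Longrightarrow> pres_eq R u w"
| pres_append: "pres_eq R u u' \<Longrightarrow> pres_eq R v v' \<Longrightarrow> pres_eq R (u @ v) (u' @ v')"
| pres_cancel: "pres_eq R [(g, b), (g, \<not> b)] []"
| pres_rel: "(u, v) \<in> R \<Longrightarrow> pres_eq R u v"

definition pres_rel_set :: "('g word \<times> 'g word) set \<Rightarrow> ('g word \<times> 'g word) set" where
  "pres_rel_set R = {(u, v). pres_eq R u v}"

definition pres_class :: "('g word \<times> 'g word) set \<Rightarrow> 'g word \<Rightarrow> 'g word set" where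
  "pres_class R u = pres_rel_set R `` {u}"

definition presented_group :: "('g word \<times> 'g word) set \<Rightarrow> 'g word set monoid" where
  "presented_group R =
    \<lparr>carrier = UNIV // pres_rel_set R,
     mult = (\<lambda>X Y. \<Union>u\<in>X. \<Union>v\<in>Y. pres_class R (u @ v)),
     one = pres_class R []\<rparr>"

lemma equiv_pres_rel_set: "equiv UNIV (pres_rel_set R)"
proof (rule equivI)
  show "refl_on UNIV (pres_rel_set R)"
    by (auto simp: refl_on_def pres_rel_set_def intro: pres_refl)
  show "sym (pres_rel_set R)"
    by (auto simp: sym_def pres_rel_set_def intro: pres_sym)
  show "trans (pres_rel_set R)"
    unfolding trans_def pres_rel_set_def using pres_trans[of R] by blast
qed auto

lemma mem_pres_class: "v \<in> pres_class R u \<longleftrightarrow> pres_eq R u v"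
  by (simp add: pres_class_def pres_rel_set_def)

lemma pres_class_eq_iff: "pres_class R u = pres_class R v \<longleftrightarrow> pres_eq R u v"
  using eq_equiv_class_iff[OF equiv_pres_rel_set[of R], of u v]
  by (simp add: pres_class_def pres_rel_set_def)

lemma carrier_presented_group: "carrier (presented_group R) = range (pres_class R)"
  by (auto simp: presented_group_def quotient_def pres_class_def)

lemma one_presented_group: "\<one>\<^bsub>presented_group R\<^esub> = pres_class R []"
  by (simp add: presented_group_def)

lemma mult_presented_group:
  "pres_class R u \<otimes>\<^bsub>presented_group R\<^esub> pres_class R v = pres_class R (u @ v)"
proof -
  have eq: "pres_class R (u' @ v') = pres_class R (u @ v)"
    if "u' \<in> pres_class R u" "v' \<in> pres_class R v" for u' v'
    using pres_sym[OF pres_append[of R u u' v v']] that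
    by (simp add: mem_pres_class pres_class_eq_iff)
  have "u \<in> pres_class R u" "v \<in> pres_class R v"
    by (simp_all add: mem_pres_class pres_refl)
  with eq have "(\<Union>u'\<in>pres_class R u. \<Union>v'\<in>pres_class R v. pres_class R (u' @ v')) = pres_class R (u @ v)"
    by blast
  then show ?thesis
    by (simp add: presented_group_def)
qed

definition word_inv :: "'g word \<Rightarrow> 'g word" where
  "word_inv u = rev (map (\<lambda>(g, b). (g, \<not> b)) u)"

lemma pres_eq_word_inv: "pres_eq R (word_inv u @ u) []"
proof (induction u)
  case Nil
  then show ?case by (simp add: word_inv_def pres_refl)
next
  case (Cons a u)
  obtain g b where a: "a = (g, b)" by (cases a)
  have "pres_eq R ([(g, \<not> b), (g, b)] @ u) ([] @ u)"
    using pres_append[OF pres_cancel[of R g "\<not> b"] pres_refl[of R u]] by simp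
  from pres_append[OF pres_refl[of R "word_inv u"] this]
  have "pres_eq R (word_inv (a # u) @ a # u) (word_inv u @ u)"
    by (simp add: word_inv_def a)
  then show ?case using Cons.IH by (rule pres_trans)
qed

lemma group_presented_group: "group (presented_group R)"
proof (rule groupI)
  fix X assume "X \<in> carrier (presented_group R)"
  then obtain u where u: "X = pres_class R u" by (auto simp: carrier_presented_group)
  have "pres_class R (word_inv u) \<otimes>\<^bsub>presented_group R\<^esub> X = \<one>\<^bsub>presented_group R\<^esub>"
    by (simp add: u mult_presented_group one_presented_group pres_class_eq_iff pres_eq_word_inv)
  then show "\<exists>Y\<in>carrier (presented_group R). Y \<otimes>\<^bsub>presented_group R\<^esub> X = \<one>\<^bsub>presented_group R\<^esub>"
    by (auto simp: carrier_presented_group)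
qed (auto simp: carrier_presented_group mult_presented_group one_presented_group)

definition thompson_rels :: "(nat word \<times> nat word) set" where
  "thompson_rels =
    {([(j, True), (i, True)], [(i, True), (Suc j, True)]) | i j. i < j}"

definition thompson_F :: "nat word set monoid" where
  "thompson_F = presented_group thompson_rels"

definition thompson_x :: "nat \<Rightarrow> nat word set" where
  "thompson_x n = pres_class thompson_rels [(n, True)]"

lemma group_thompson_F: "group thompson_F"
  by (simp add: thompson_F_def group_presented_group)

lemma thompson_x_in_carrier: "thompson_x n \<in> carrier thompson_F"
  by (simp add: thompson_F_def thompson_x_def carrier_presented_group)

lemma thompson_x_relation:
  assumes "i < j"
  shows "thompson_x j \<otimes>\<^bsub>thompson_F\<^esub> thompson_x i = thompson_x i \<otimes>\<^bsub>thompson_F\<^esub> thompson_x (Suc j)"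
proof -
  have "([(j, True), (i, True)], [(i, True), (Suc j, True)]) \<in> thompson_rels"
    using assms by (auto simp: thompson_rels_def)
  then show ?thesis
    by (simp add: thompson_F_def thompson_x_def mult_presented_group pres_class_eq_iff pres_rel)
qed

end

(*
  Left multiplication by x_i joins the i-th and (i+1)-st tree of a forest. Let the 0-th and 3-rd
  tree of a 4-tree forest be a left and a right comb with teeth L and R; then it encodes a sequence
  of trees L, c, d, R with a marked gap between c and d. Multiplying by x_0, x_1, x_2 moves the
  mark onto d, joins c and d below the mark, or moves the mark onto c. Bound the height of the
  trees by k and the lengths of L and R by N, and weight a forest by z^(number of leaves), with z
  chosen such that all trees of height at most k have total weight 1. Then the source has weight
  (N+1)^2 and the image at most (N+2)^2 + z (N+1)^2, where z is the total weight of the trees of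
  height exactly k+1. For k = 6 one gets z < 1/3, so a large N gives a ratio below 4/3, and some
  level set of the number of leaves, which multiplication preserves, does as well.
*)
theory Submission
  imports Defs "HOL-Library.Countable_Set"
begin

section \<open>Trees in Thompson's group\<close>

datatype btree = Leaf | Node btree btree

instance btree :: countable
  by countable_datatype

primrec leaves :: "btree \<Rightarrow> nat" where
  "leaves Leaf = 1"
| "leaves (Node l r) = leaves l + leaves r"

text \<open>
  A bijective pairing is needed so that joining two entries of a sequence is invertible; this
  gives an action of the whole group that tells different forests apart.
\<close>

lemma ex_pairing_extending_Node:
  "\<exists>(e :: btree \<Rightarrow> nat) p. inj e \<and> bij p \<and> (\<forall>l r. p (e l, e r) = e (Node l r))"
proof -
  \<comment> \<open>Even codes leave the odd numbers free, so both \<open>- D\<close> and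
    \<open>- N\<close> are countably infinite, and a bijection between them completes
    \<open>q\<close> to \<open>p\<close>.\<close>
  define e :: "btree \<Rightarrow> nat" where "e t = 2 * to_nat t" for t
  have inj_e: "inj e" by (auto simp: e_def inj_def)
  have inj_pair: "inj (map_prod e e)" using inj_e by (simp add: prod.inj_map)
  define D where "D = range (map_prod e e)"
  define N where "N = range (\<lambda>(l, r). e (Node l r))"
  define q where "q = (\<lambda>(l, r). e (Node l r)) \<circ> inv_into UNIV (map_prod e e)"
  have q_e: "q (e l, e r) = e (Node l r)" for l r
    using inv_f_f[OF inj_pair, of "(l, r)"] by (simp add: q_def)
  have q: "bij_betw q D N"
    unfolding bij_betw_def
  proof
    show "inj_on q D"
      using inj_e by (auto simp: inj_on_def D_def q_e dest: injD)
    show "q ` D = N"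
      by (auto simp: D_def N_def image_image q_e intro!: image_cong)
  qed
  have odd_notin: "2 * k + 1 \<notin> range e" for k
  proof
    assume "2 * k + 1 \<in> range e"
    then obtain t where "2 * k + 1 = 2 * to_nat (t :: btree)" by (auto simp: e_def)
    then show False by presburger
  qed
  have "range (\<lambda>k::nat. (2 * k + 1, 0)) \<subseteq> - D"
    using odd_notin by (auto simp: D_def)
  moreover have "infinite (range (\<lambda>k::nat. (2 * k + 1, 0 :: nat)))"
    by (rule range_inj_infinite) (auto simp: inj_def)
  ultimately have "infinite (- D)" using finite_subset by blast
  have "range (\<lambda>k::nat. 2 * k + 1) \<subseteq> - N"
    using odd_notin by (auto simp: N_def)
  moreover have "infinite (range (\<lambda>k::nat. 2 * k + 1))"
    by (rule range_inj_infinite) (auto simp: inj_def)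
  ultimately have "infinite (- N)" using finite_subset by blast
  have "bij_betw (from_nat_into (- N) \<circ> to_nat_on (- D)) (- D) (- N)"
    using to_nat_on_infinite[OF _ \<open>infinite (- D)\<close>] bij_betw_from_nat_into[OF _ \<open>infinite (- N)\<close>]
    by (intro bij_betw_trans) auto
  then obtain q' where q': "bij_betw q' (- D) (- N)" by blast
  define p where "p x = (if x \<in> D then q x else q' x)" for x
  have "bij_betw p (D \<union> - D) (N \<union> - N)"
  proof (rule bij_betw_combine)
    show "bij_betw p D N" using q by (subst bij_betw_cong[where g = q]) (auto simp: p_def)
    show "bij_betw p (- D) (- N)" using q' by (subst bij_betw_cong[where g = q']) (auto simp: p_def)
  qed auto
  then have "bij p" by simp
  moreover have "p (e l, e r) = e (Node l r)" for l r
    by (simp add: p_def q_e D_def image_iff) metis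
  ultimately show ?thesis using inj_e by blast
qed

text \<open>
  The word whose product with the trivial forest grows the tree at position \<open>i\<close>. Multiplying by
  a generator \<open>i\<close> on the left joins the trees at positions \<open>i\<close> and \<open>i + 1\<close>, so words act from
  right to left.
\<close>

primrec tree_word :: "nat \<Rightarrow> btree \<Rightarrow> nat word" where
  "tree_word i Leaf = []"
| "tree_word i (Node l r) = (i, True) # tree_word (Suc i) r @ tree_word i l"

abbreviation F_eq :: "nat word \<Rightarrow> nat word \<Rightarrow> bool" (infix "\<approx>" 50) where
  "u \<approx> v \<equiv> pres_eq thompson_rels u v"

lemma F_eq_append_left: "u \<approx> v \<Longrightarrow> w @ u \<approx> w @ v"
  by (rule pres_append[OF pres_refl])

lemma F_eq_append_right: "u \<approx> v \<Longrightarrow> u @ w \<approx> v @ w"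
  by (rule pres_append[OF _ pres_refl])

text \<open>Moving right past a letter of index above \<open>i + 1\<close>, the letter
  \<open>i\<close> lowers that index by one; all letters in the word of the shifted tree have index
  at least \<open>j + 1\<close>.\<close>

lemma tree_word_shift:
  "i < j \<Longrightarrow> (i, True) # tree_word (Suc j) t \<approx> tree_word j t @ [(i, True)]"
proof (induction t arbitrary: j)
  case Leaf
  then show ?case by (simp add: pres_refl)
next
  case (Node l r)
  have "[(i, True), (Suc j, True)] \<approx> [(j, True), (i, True)]"
    using Node.prems by (intro pres_sym[OF pres_rel]) (auto simp: thompson_rels_def)
  from F_eq_append_right[OF this, of "tree_word (Suc (Suc j)) r @ tree_word (Suc j) l"]
  have 1: "(i, True) # tree_word (Suc j) (Node l r)
      \<approx> (j, True) # (i, True) # tree_word (Suc (Suc j)) r @ tree_word (Suc j) l"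
    by simp
  have "(i, True) # tree_word (Suc (Suc j)) r \<approx> tree_word (Suc j) r @ [(i, True)]"
    using Node.prems by (intro Node.IH) simp
  from F_eq_append_left[OF F_eq_append_right[OF this], of "[(j, True)]" "tree_word (Suc j) l"]
  have 2: "(j, True) # (i, True) # tree_word (Suc (Suc j)) r @ tree_word (Suc j) l
      \<approx> (j, True) # tree_word (Suc j) r @ (i, True) # tree_word (Suc j) l"
    by simp
  from F_eq_append_left[OF Node.IH(1)[OF Node.prems], of "(j, True) # tree_word (Suc j) r"]
  have 3: "(j, True) # tree_word (Suc j) r @ (i, True) # tree_word (Suc j) l
      \<approx> tree_word j (Node l r) @ [(i, True)]"
    by simp
  show ?case
    using pres_trans[OF 1 pres_trans[OF 2 3]] .
qed

text \<open>Earlier positions are grown first: each join shifts all later entries, which must still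
  be leaves at that time.\<close>

primrec forest_word :: "nat \<Rightarrow> btree list \<Rightarrow> nat word" where
  "forest_word i [] = []"
| "forest_word i (t # ts) = forest_word (Suc i) ts @ tree_word i t"

lemma forest_word_shift:
  "i < j \<Longrightarrow> (i, True) # forest_word (Suc j) ts \<approx> forest_word j ts @ [(i, True)]"
proof (induction ts arbitrary: j)
  case Nil
  then show ?case by (simp add: pres_refl)
next
  case (Cons t ts)
  have "(i, True) # forest_word (Suc (Suc j)) ts \<approx> forest_word (Suc j) ts @ [(i, True)]"
    using Cons by simp
  from F_eq_append_right[OF this, of "tree_word (Suc j) t"]
    F_eq_append_left[OF tree_word_shift[OF Cons.prems], of "forest_word (Suc j) ts" t]
  show ?case by (auto intro: pres_trans)
qed

text \<open>The new letter passes the words of \<open>ts\<close>, lowering their positions by one,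
  and then meets the words of \<open>r\<close> and \<open>l\<close>, with which it forms the word of
  \<open>Node l r\<close>. The words of \<open>us\<close> lie further right and stay
  untouched.\<close>

lemma forest_word_join:
  "(i + length us, True) # forest_word i (us @ l # r # ts) \<approx> forest_word i (us @ Node l r # ts)"
proof (induction us arbitrary: i)
  case Nil
  from F_eq_append_right[OF forest_word_shift[of i "Suc i" ts], of "tree_word (Suc i) r @ tree_word i l"]
  show ?case by simp
next
  case (Cons u us)
  from F_eq_append_right[OF Cons.IH[of "Suc i"], of "tree_word i u"]
  show ?case by simp
qed

section \<open>An action on sequences that separates forests\<close>

locale forest_action =
  fixes e :: "btree \<Rightarrow> nat" and p :: "nat \<times> nat \<Rightarrow> nat"
  assumes inj_e: "inj e" and bij_p: "bij p" and p_e: "p (e l, e r) = e (Node l r)"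
begin

definition join :: "nat \<Rightarrow> (nat \<Rightarrow> nat) \<Rightarrow> nat \<Rightarrow> nat" where
  "join i s n = (if n < i then s n else if n = i then p (s i, s (Suc i)) else s (Suc n))"

definition split :: "nat \<Rightarrow> (nat \<Rightarrow> nat) \<Rightarrow> nat \<Rightarrow> nat" where
  "split i s n = (if n < i then s n else if n = i then fst (inv_into UNIV p (s i))
     else if n = Suc i then snd (inv_into UNIV p (s i)) else s (n - 1))"

lemma split_join: "split i (join i s) = s"
  using bij_p by (auto simp: split_def join_def fun_eq_iff bij_is_inj)

lemma join_split: "join i (split i s) = s"
  using bij_p by (auto simp: split_def join_def fun_eq_iff bij_is_surj surj_f_inv_f)

lemma join_join: "i < j \<Longrightarrow> join j (join i s) = join i (join (Suc j) s)"
  by (auto simp: join_def fun_eq_iff)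

primrec act :: "nat word \<Rightarrow> (nat \<Rightarrow> nat) \<Rightarrow> nat \<Rightarrow> nat" where
  "act [] s = s"
| "act (x # u) s = (if snd x then join (fst x) else split (fst x)) (act u s)"

lemma act_append: "act (u @ v) s = act u (act v s)"
  by (induction u) auto

text \<open>The relations are respected by \<open>join_join\<close>, the cancellations by the
  bijectivity of \<open>p\<close>.\<close>

lemma act_cong: "u \<approx> v \<Longrightarrow> act u s = act v s"
proof (induction arbitrary: s rule: pres_eq.induct)
  case (pres_rel u v)
  then show ?case by (auto simp: thompson_rels_def join_join)
qed (auto simp: act_append split_join join_split)

text \<open>Each join shifts the later entries, which stays invisible while they are all
  \<open>e Leaf\<close>.\<close>

lemma act_tree_word:
  "(\<And>n. n \<ge> i \<Longrightarrow> s n = e Leaf) \<Longrightarrow> act (tree_word i t) s = s(i := e t)"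
proof (induction t arbitrary: i s)
  case Leaf
  then show ?case by (auto simp: fun_eq_iff)
next
  case (Node l r)
  have "act (tree_word (Suc i) r @ tree_word i l) s = s(i := e l, Suc i := e r)"
    using Node.prems by (simp add: act_append Node.IH) (simp add: fun_eq_iff)
  then show ?case using Node.prems by (auto simp: join_def fun_eq_iff p_e)
qed

lemma act_forest_word:
  "(\<And>n. n \<ge> i \<Longrightarrow> s n = e Leaf) \<Longrightarrow>
    act (forest_word i ts) s = (\<lambda>n. if i \<le> n \<and> n < i + length ts then e (ts ! (n - i)) else s n)"
proof (induction ts arbitrary: i s)
  case Nil
  then show ?case by auto
next
  case (Cons t ts)
  have "act (forest_word (Suc i) ts) (s(i := e t)) =
      (\<lambda>n. if Suc i \<le> n \<and> n < Suc i + length ts then e (ts ! (n - Suc i)) else (s(i := e t)) n)"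
    using Cons.prems by (intro Cons.IH) simp
  moreover have "act (tree_word i t) s = s(i := e t)"
    using Cons.prems by (rule act_tree_word)
  ultimately show ?case
    by (simp add: act_append) (auto simp: fun_eq_iff nth_Cons')
qed

text \<open>Acting on the constant sequence \<open>e Leaf\<close> displays the codes of the trees.
  Equal lengths are assumed because trailing leaves contribute nothing to the word.\<close>

lemma forest_word_inj:
  assumes "forest_word 0 ts \<approx> forest_word 0 us" "length ts = length us"
  shows "ts = us"
proof (rule nth_equalityI)
  fix n assume n: "n < length ts"
  have "act (forest_word 0 ts) (\<lambda>_. e Leaf) n = act (forest_word 0 us) (\<lambda>_. e Leaf) n"
    by (simp add: act_cong[OF assms(1)])
  then have "e (ts ! n) = e (us ! n)"
    using n assms(2) by (simp add: act_forest_word)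
  then show "ts ! n = us ! n"
    using inj_e by (simp add: inj_eq)
qed (use assms in simp)

end

section \<open>Forests as group elements\<close>

definition forest :: "btree list \<Rightarrow> nat word set" where
  "forest ts = pres_class thompson_rels (forest_word 0 ts)"

lemma forest_in_carrier: "forest ts \<in> carrier thompson_F"
  by (simp add: forest_def thompson_F_def carrier_presented_group)

lemma forest_inj:
  assumes "forest ts = forest us" "length ts = length us"
  shows "ts = us"
proof -
  obtain e :: "btree \<Rightarrow> nat" and p where "inj e" "bij p" "\<forall>l r. p (e l, e r) = e (Node l r)"
    using ex_pairing_extending_Node by blast
  then interpret forest_action e p by unfold_locales auto
  show ?thesis
    using assms by (intro forest_word_inj) (simp_all add: forest_def pres_class_eq_iff)
qed

lemma thompson_x_mult_forest:
  "thompson_x (length us) \<otimes>\<^bsub>thompson_F\<^esub> forest (us @ l # r # ts) = forest (us @ Node l r # ts)"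
  using forest_word_join[of 0 us l r ts]
  by (simp add: thompson_x_def thompson_F_def forest_def mult_presented_group pres_class_eq_iff)

section \<open>Left and right combs\<close>

text \<open>A left comb gains its last tooth, and a right comb its first, by one \<open>Node\<close>
  at the root, so joining a tree to the comb beside it extends the list of teeth.\<close>

definition left_comb :: "btree list \<Rightarrow> btree" where
  "left_comb = foldl Node Leaf"

definition right_comb :: "btree list \<Rightarrow> btree" where
  "right_comb ts = foldr Node ts Leaf"

lemma left_comb_snoc: "left_comb (ts @ [t]) = Node (left_comb ts) t"
  by (simp add: left_comb_def)

lemma right_comb_Cons: "right_comb (t # ts) = Node t (right_comb ts)"
  by (simp add: right_comb_def)

lemma left_comb_inj: "left_comb ts = left_comb us \<Longrightarrow> ts = us"
proof (induction ts arbitrary: us rule: rev_induct)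
  case Nil
  then show ?case by (cases us rule: rev_cases) (auto simp: left_comb_def)
next
  case (snoc t ts)
  then show ?case by (cases us rule: rev_cases) (auto simp: left_comb_def)
qed

lemma right_comb_inj: "right_comb ts = right_comb us \<Longrightarrow> ts = us"
proof (induction ts arbitrary: us)
  case Nil
  then show ?case by (cases us) (auto simp: right_comb_def)
next
  case (Cons t ts)
  then show ?case by (cases us) (auto simp: right_comb_def)
qed

section \<open>The encoding of marked sequences of trees\<close>

type_synonym gap_forest = "btree list \<times> btree \<times> btree \<times> btree list"
type_synonym pointed_forest = "btree list \<times> btree \<times> btree list"

definition gap_elem :: "gap_forest \<Rightarrow> nat word set" where
  "gap_elem = (\<lambda>(L, c, d, R). forest [left_comb L, c, d, right_comb R])"

definition pointed_elem :: "pointed_forest \<Rightarrow> nat word set" where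
  "pointed_elem = (\<lambda>(L, c, R). forest [left_comb L, c, right_comb R])"

lemma inj_gap_elem: "inj gap_elem"
  by (auto simp: inj_def gap_elem_def dest!: forest_inj left_comb_inj right_comb_inj)

lemma thompson_x_mult_gap_elem:
  "thompson_x 0 \<otimes>\<^bsub>thompson_F\<^esub> gap_elem (L, c, d, R) = pointed_elem (L @ [c], d, R)"
  "thompson_x 1 \<otimes>\<^bsub>thompson_F\<^esub> gap_elem (L, c, d, R) = pointed_elem (L, Node c d, R)"
  "thompson_x 2 \<otimes>\<^bsub>thompson_F\<^esub> gap_elem (L, c, d, R) = pointed_elem (L, c, d # R)"
  using thompson_x_mult_forest[of "[]" "left_comb L" c "[d, right_comb R]"]
    thompson_x_mult_forest[of "[left_comb L]" c d "[right_comb R]"]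
    thompson_x_mult_forest[of "[left_comb L, c]" d "right_comb R" "[]"]
  by (simp_all add: gap_elem_def pointed_elem_def left_comb_snoc right_comb_Cons
      numeral_2_eq_2)

section \<open>Counting by leaves\<close>

text \<open>Trees of height at most \<open>k\<close>, where \<open>Leaf\<close> has height
  0.\<close>

primrec trees_upto :: "nat \<Rightarrow> btree set" where
  "trees_upto 0 = {Leaf}"
| "trees_upto (Suc k) = insert Leaf (case_prod Node ` (trees_upto k \<times> trees_upto k))"

primrec lists_upto :: "'a set \<Rightarrow> nat \<Rightarrow> 'a list set" where
  "lists_upto T 0 = {[]}"
| "lists_upto T (Suc n) = insert [] (case_prod (#) ` (T \<times> lists_upto T n))"

lemma finite_trees_upto [simp]: "finite (trees_upto k)"
  by (induction k) auto

lemma finite_lists_upto [simp]: "finite T \<Longrightarrow> finite (lists_upto T n)"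
  by (induction n) auto

lemma trees_upto_Suc_mono: "trees_upto k \<subseteq> trees_upto (Suc k)"
  by (induction k) auto

lemma lists_upto_iff: "xs \<in> lists_upto T n \<longleftrightarrow> set xs \<subseteq> T \<and> length xs \<le> n"
proof (induction n arbitrary: xs)
  case (Suc n)
  then show ?case by (cases xs) (auto simp: image_iff)
qed auto

definition forest_leaves :: "btree list \<Rightarrow> nat" where
  "forest_leaves ts = sum_list (map leaves ts)"

definition gap_leaves :: "gap_forest \<Rightarrow> nat" where
  "gap_leaves = (\<lambda>(L, c, d, R). forest_leaves L + leaves c + leaves d + forest_leaves R)"

definition pointed_leaves :: "pointed_forest \<Rightarrow> nat" where
  "pointed_leaves = (\<lambda>(L, c, R). forest_leaves L + leaves c + forest_leaves R)"

text \<open>The generating polynomial of these trees by leaves; as \<open>k\<close> grows, its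
  values follow the orbit of 0 under w -> w^2 + z, from the first iterate on.\<close>

primrec tree_weight :: "nat \<Rightarrow> real \<Rightarrow> real" where
  "tree_weight 0 z = z"
| "tree_weight (Suc k) z = z + (tree_weight k z)\<^sup>2"

lemma sum_trees_upto: "(\<Sum>t\<in>trees_upto k. z ^ leaves t) = tree_weight k z"
proof (induction k)
  case (Suc k)
  have inj: "inj_on (case_prod Node) (trees_upto k \<times> trees_upto k)"
    by (auto simp: inj_on_def)
  have "(\<Sum>t\<in>trees_upto (Suc k). z ^ leaves t)
      = z + (\<Sum>(l, r)\<in>trees_upto k \<times> trees_upto k. z ^ leaves l * z ^ leaves r)"
    by (subst trees_upto.simps, subst sum.insert)
      (auto simp: sum.reindex[OF inj] power_add intro!: sum.cong)
  also have "\<dots> = z + (tree_weight k z)\<^sup>2"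
    by (simp add: Suc.IH[symmetric] sum_product sum.cartesian_product power2_eq_square)
  finally show ?case by simp
qed simp

text \<open>Weights multiply along a list, so each of the lengths 0 to \<open>n\<close> contributes
  a power of 1.\<close>

lemma sum_lists_upto:
  assumes "finite T" "(\<Sum>t\<in>T. z ^ leaves t) = (1 :: real)"
  shows "(\<Sum>ts\<in>lists_upto T n. z ^ forest_leaves ts) = real (Suc n)"
proof (induction n)
  case (Suc n)
  have inj: "inj_on (case_prod (#)) (T \<times> lists_upto T n)"
    by (auto simp: inj_on_def)
  have "(\<Sum>ts\<in>lists_upto T (Suc n). z ^ forest_leaves ts)
      = 1 + (\<Sum>(t, ts)\<in>T \<times> lists_upto T n. z ^ leaves t * z ^ forest_leaves ts)"
    using assms(1) by (subst lists_upto.simps, subst sum.insert)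
      (auto simp: sum.reindex[OF inj] power_add forest_leaves_def intro!: sum.cong)
  also have "\<dots> = 1 + (\<Sum>t\<in>T. z ^ leaves t) * (\<Sum>ts\<in>lists_upto T n. z ^ forest_leaves ts)"
    by (simp add: sum_product sum.cartesian_product)
  finally show ?case by (simp add: assms Suc.IH)
qed (simp add: forest_leaves_def)

declare trees_upto.simps(2) [simp del] lists_upto.simps(2) [simp del]

lemma sum_pointed:
  "(\<Sum>x\<in>A \<times> B \<times> C. (z::real) ^ pointed_leaves x)
    = (\<Sum>L\<in>A. z ^ forest_leaves L) * (\<Sum>c\<in>B. z ^ leaves c) * (\<Sum>R\<in>C. z ^ forest_leaves R)"
  by (simp add: sum.cartesian_product' pointed_leaves_def power_add mult.assoc
      flip: sum_distrib_left sum_distrib_right)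

lemma sum_gap:
  "(\<Sum>x\<in>A \<times> B \<times> C \<times> D. (z::real) ^ gap_leaves x)
    = (\<Sum>L\<in>A. z ^ forest_leaves L) * (\<Sum>c\<in>B. z ^ leaves c) * (\<Sum>d\<in>C. z ^ leaves d)
      * (\<Sum>R\<in>D. z ^ forest_leaves R)"
  by (simp add: sum.cartesian_product' gap_leaves_def power_add mult.assoc
      flip: sum_distrib_left sum_distrib_right)

text \<open>Both sums combine level sizes with the same nonnegative coefficients
  \<open>z ^ n\<close>; if the inequality failed on every level, it would fail for the sums.\<close>

lemma ex_level_card_less:
  fixes z c :: real
  assumes "finite U" "finite S" "z > 0"
    and "(\<Sum>u\<in>U. z ^ f u) < c * (\<Sum>s\<in>S. z ^ g s)"
  shows "\<exists>n. real (card {u \<in> U. f u = n}) < c * real (card {s \<in> S. g s = n})"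
proof (rule ccontr)
  define I where "I = f ` U \<union> g ` S"
  have "finite I" using assms by (simp add: I_def)
  have level_U: "(\<Sum>u\<in>U. z ^ f u) = (\<Sum>n\<in>I. z ^ n * real (card {u \<in> U. f u = n}))"
    using sum.group[OF \<open>finite U\<close> \<open>finite I\<close>, of f "\<lambda>u. z ^ f u"]
    by (simp add: I_def mult.commute)
  have level_S: "(\<Sum>s\<in>S. z ^ g s) = (\<Sum>n\<in>I. z ^ n * real (card {s \<in> S. g s = n}))"
    using sum.group[OF \<open>finite S\<close> \<open>finite I\<close>, of g "\<lambda>s. z ^ g s"]
    by (simp add: I_def mult.commute)
  assume "\<not> ?thesis"
  then have *: "c * real (card {s \<in> S. g s = n}) \<le> real (card {u \<in> U. f u = n})" for n
    by (simp add: not_less)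
  have "c * (\<Sum>s\<in>S. z ^ g s) = (\<Sum>n\<in>I. z ^ n * (c * real (card {s \<in> S. g s = n})))"
    by (simp add: level_S sum_distrib_left mult.left_commute)
  also have "\<dots> \<le> (\<Sum>n\<in>I. z ^ n * real (card {u \<in> U. f u = n}))"
    using \<open>z > 0\<close> * by (intro sum_mono mult_left_mono) auto
  also have "\<dots> = (\<Sum>u\<in>U. z ^ f u)"
    by (simp add: level_U)
  finally show False using assms by simp
qed

text \<open>The bound 1/3 is chosen because the ratio of the weights tends to 1 + z as the comb
  lengths grow.\<close>

lemma ex_weight_one: "\<exists>k z. 0 < z \<and> z < 1 / 3 \<and> tree_weight k z = 1"
proof -
  have 0: "tree_weight k 0 = 0" for k by (induction k) auto
  have "continuous_on {0..1 / 3} (tree_weight k)" for k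
    by (induction k) (simp_all add: continuous_on_add continuous_on_power)
  \<comment> \<open>6 is the least index whose value at 1/3 exceeds 1 (about 1.04, after 0.84); one
    exists because the orbit diverges for z > 1/4.\<close>
  moreover have third: "tree_weight 6 (1 / 3) > 1"
    by (simp add: numeral_eq_Suc power2_eq_square)
  ultimately obtain z where z: "0 \<le> z" "z \<le> 1 / 3" "tree_weight 6 z = 1"
    using IVT'[of "tree_weight 6" 0 1 "1 / 3"] by (auto simp: 0)
  moreover have "z \<noteq> 0" using z 0 by (metis zero_neq_one)
  moreover have "z \<noteq> 1 / 3" using z third by (metis less_irrefl)
  ultimately show ?thesis by force
qed

theorem theorem1:
  shows "\<exists>S. S \<subseteq> carrier thompson_F \<and> finite S \<and>
    real (card ({thompson_x 0, thompson_x 1, thompson_x 2} <#>\<^bsub>thompson_F\<^esub> S)) < 4 / 3 * real (card S)"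
proof -
  obtain k z where z: "0 < z" "z < 1 / 3" "tree_weight k z = 1"
    using ex_weight_one by blast
  \<comment> \<open>This makes \<open>(1 / 3 - z) * (N + 1)^2\<close> exceed
    \<open>3 * (N + 1)\<close>, hence also \<open>(N + 2)^2 - (N + 1)^2 = 2 * N + 3\<close>.\<close>
  obtain N :: nat where N: "3 < real N * (1 / 3 - z)"
    using ex_less_of_nat_mult[of "1 / 3 - z" 3] z by auto
  define T where "T = trees_upto k"
  have finite_T: "finite T" by (simp add: T_def)
  have T: "(\<Sum>t\<in>T. z ^ leaves t) = 1"
    using z by (simp add: T_def sum_trees_upto)
  have lists: "(\<Sum>ts\<in>lists_upto T n. z ^ forest_leaves ts) = real (Suc n)" for n
    by (rule sum_lists_upto[OF finite_T T])
  \<comment> \<open>Height at most \<open>k + 1\<close> has weight z + 1^2; removing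
    \<open>T\<close>, of weight 1, leaves z.\<close>
  define T' where "T' = trees_upto (Suc k) - T"
  have "(\<Sum>t\<in>trees_upto (Suc k). z ^ leaves t) = 1 + z"
    using z by (simp add: sum_trees_upto)
  moreover have "T \<subseteq> trees_upto (Suc k)"
    unfolding T_def by (rule trees_upto_Suc_mono)
  ultimately have T': "(\<Sum>t\<in>T'. z ^ leaves t) = z"
    by (simp add: T'_def sum_diff T)
  define G where "G = lists_upto T N \<times> T \<times> T \<times> lists_upto T N"
  \<comment> \<open>The first piece allows \<open>Suc N\<close> teeth because x_0 and x_2 lengthen a
    comb; the second takes the joined trees that are too high for \<open>T\<close>.\<close>
  define P where "P = lists_upto T (Suc N) \<times> T \<times> lists_upto T (Suc N) \<union>
    lists_upto T N \<times> T' \<times> lists_upto T N"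
  have finite: "finite G" "finite P"
    using finite_T by (auto simp: G_def P_def T'_def)
  have "(\<Sum>x\<in>P. z ^ pointed_leaves x) = real (N + 2) ^ 2 + z * real (N + 1) ^ 2"
    using finite_T unfolding P_def
    by (subst sum.union_disjoint)
      (auto simp: T'_def[symmetric] sum_pointed lists T T' power2_eq_square, auto simp: T'_def)
  also have "\<dots> < 4 / 3 * real (N + 1) ^ 2"
  proof -
    have "2 * real N + 3 < (1 / 3 - z) * real (N + 1) ^ 2"
    proof -
      have "2 * real N + 3 \<le> 3 * real (N + 1)" by simp
      also have "\<dots> < (real N * (1 / 3 - z)) * real (N + 1)"
        using N by (intro mult_strict_right_mono) auto
      also have "\<dots> \<le> (1 / 3 - z) * real (N + 1) ^ 2"
        unfolding power2_eq_square mult.assoc[symmetric] mult.commute[of "1 / 3 - z"]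
        using z by (intro mult_right_mono) auto
      finally show ?thesis .
    qed
    then show ?thesis by (simp add: power2_eq_square algebra_simps)
  qed
  also have "real (N + 1) ^ 2 = (\<Sum>x\<in>G. z ^ gap_leaves x)"
    by (simp add: G_def sum_gap lists T power2_eq_square)
  finally obtain n where n: "real (card {x \<in> P. pointed_leaves x = n})
      < 4 / 3 * real (card {x \<in> G. gap_leaves x = n})"
    using ex_level_card_less[OF finite(2,1) z(1)] by blast
  define S where "S = gap_elem ` {x \<in> G. gap_leaves x = n}"
  have card_S: "card S = card {x \<in> G. gap_leaves x = n}"
    unfolding S_def by (rule card_image) (rule inj_on_subset[OF inj_gap_elem subset_UNIV])
  have "{thompson_x 0, thompson_x 1, thompson_x 2} <#>\<^bsub>thompson_F\<^esub> S
      \<subseteq> pointed_elem ` {x \<in> P. pointed_leaves x = n}"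
  proof
    fix y assume "y \<in> {thompson_x 0, thompson_x 1, thompson_x 2} <#>\<^bsub>thompson_F\<^esub> S"
    then obtain a x where a: "a \<in> {thompson_x 0, thompson_x 1, thompson_x 2}"
      and x: "x \<in> G" "gap_leaves x = n" "y = a \<otimes>\<^bsub>thompson_F\<^esub> gap_elem x"
      unfolding set_mult_def S_def by blast
    obtain L c d R where "x = (L, c, d, R)" by (cases x)
    with x have G: "(L, c, d, R) \<in> G" and l: "gap_leaves (L, c, d, R) = n"
      and y: "y = a \<otimes>\<^bsub>thompson_F\<^esub> gap_elem (L, c, d, R)"
      by simp_all
    have "Node c d \<in> trees_upto (Suc k)"
      using G by (auto simp: G_def T_def trees_upto.simps(2))
    \<comment> \<open>If \<open>Node c d\<close> still has height at most \<open>k\<close>, it falls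
      into the first piece.\<close>
    then have "(L @ [c], d, R) \<in> P" "(L, Node c d, R) \<in> P" "(L, c, d # R) \<in> P"
      using G by (auto simp: G_def P_def T'_def lists_upto_iff)
    \<comment> \<open>Only teeth are counted, not the final \<open>Leaf\<close> of a comb, so a tree
      absorbed by a comb keeps its contribution.\<close>
    moreover have "pointed_leaves (L @ [c], d, R) = n" "pointed_leaves (L, Node c d, R) = n"
        "pointed_leaves (L, c, d # R) = n"
      using l by (auto simp: gap_leaves_def pointed_leaves_def forest_leaves_def)
    moreover have "y \<in> {pointed_elem (L @ [c], d, R), pointed_elem (L, Node c d, R),
        pointed_elem (L, c, d # R)}"
      using a y thompson_x_mult_gap_elem by auto
    ultimately show "y \<in> pointed_elem ` {x \<in> P. pointed_leaves x = n}"
      by blast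
  qed
  then have "card ({thompson_x 0, thompson_x 1, thompson_x 2} <#>\<^bsub>thompson_F\<^esub> S)
      \<le> card (pointed_elem ` {x \<in> P. pointed_leaves x = n})"
    by (rule card_mono[rotated]) (simp add: finite)
  also have "\<dots> \<le> card {x \<in> P. pointed_leaves x = n}"
    by (rule card_image_le) (simp add: finite)
  finally have "real (card ({thompson_x 0, thompson_x 1, thompson_x 2} <#>\<^bsub>thompson_F\<^esub> S))
      < 4 / 3 * real (card S)"
    using n by (simp add: card_S)
  moreover have "S \<subseteq> carrier thompson_F"
    by (auto simp: S_def gap_elem_def forest_in_carrier)
  moreover have "finite S" using finite by (simp add: S_def)
  ultimately show ?thesis by blast
qed

end
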